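(* Let $g_1^{ij}(u)$ and $g_2^{ij}(u)$ be two (Riemannian or pseudo-Riemannian) contravariant metrics, and let $v^i_j(u)=g_1^{is}(u)\,g_{2,sj}(u)$. 1) If for any linear combination $g^{ij}(u)=\lambda_1 g_1^{ij}(u)+\lambda_2 g_2^{ij}(u)$, where $\lambda_1,\lambda_2$ are arbitrary constants such that $\det(g^{ij}(u))\not\equiv 0$, the coefficients of the Levi-Civita connections satisfy $$\Gamma^{ij}_k(u)=\lambda_1\Gamma^{ij}_{1,k}(u)+\lambda_2\Gamma^{ij}_{2,k}(u),$$ then the Nijenhuis tensor of the affinor $v^i_j(u)$ vanishes. Thus, for any two compatible or almost compatible metrics, the corresponding Nijenhuis tensor always vanishes. 2) If the pair of metrics $g_1^{ij}(u)$, $g_2^{ij}(u)$ is nonsingular, that is, the roots $\lambda$ of the equation $\det(g_1^{ij}(u)-\lambda g_2^{ij}(u))=0$ are distinct, then it follows from the vanishing of the Nijenhuis tensor of the affinor $v^i_j(u)$ that the metrics $g_1^{ij}(u)$ and $g_2^{ij}(u)$ are compatible. Thus, a nonsingular pair of metrics is compatible if and only if the metrics are almost compatible.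
   Context: Here $u=(u^1,\dots,u^N)$ are local coordinates; summation over repeated upper and lower indices is understood. A contravariant metric $g^{ij}(u)$ is a smooth symmetric nondegenerate contravariant 2-tensor, with inverse $g_{ij}(u)$, $g^{is}g_{sj}=\delta^i_j$; subscripts $1,2$ refer to $g_1,g_2$. $\Gamma^i_{jk}$ are the Christoffel symbols of the Levi-Civita connection of $g$ and $$\Gamma^{ij}_k=g^{is}\Gamma^j_{sk},\qquad R^i_{jkl}=\frac{\partial\Gamma^i_{jl}}{\partial u^k}-\frac{\partial\Gamma^i_{jk}}{\partial u^l}+\Gamma^i_{pk}\Gamma^p_{jl}-\Gamma^i_{pl}\Gamma^p_{jk},\qquad R^{ij}_{kl}=g^{is}R^j_{skl}.$$ Two metrics $g_1,g_2$ are called almost compatible if for every linear combination $g^{ij}=\lambda_1g_1^{ij}+\lambda_2g_2^{ij}$ ($\lambda_1,\lambda_2$ constants with $\det(g^{ij})\not\equiv0$) one has $\Gamma^{ij}_k=\lambda_1\Gamma^{ij}_{1,k}+\lambda_2\Gamma^{ij}_{2,k}$. They are called compatible if, for every such linear combination, both $\Gamma^{ij}_k=\lambda_1\Gamma^{ij}_{1,k}+\lambda_2\Gamma^{ij}_{2,k}$ and $R^{ij}_{kl}=\lambda_1R^{ij}_{1,kl}+\lambda_2R^{ij}_{2,kl}$ hold. The Nijenhuis tensor of an affinor ((1,1)-tensor field) $v^i_j$ is $$N^k_{ij}=v^s_i\frac{\partial v^k_j}{\partial u^s}-v^s_j\frac{\partial v^k_i}{\partial u^s}+v^k_s\frac{\partial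 v^s_i}{\partial u^j}-v^k_s\frac{\partial v^s_j}{\partial u^i}.$$ *)

theory Defs
  imports "HOL-Analysis.Analysis"
begin

text \<open>Tensor fields are given by their components in fixed coordinates on an open set
  \<open>U\<close> of \<open>real ^ 'n\<close>, so \<open>N = CARD('n)\<close>. For a matrix-valued field \<open>A\<close>, the first (upper or
  left) index is the row: \<open>A u $ i $ j\<close>.\<close>

definition partial :: "'n::finite \<Rightarrow> (real^'n \<Rightarrow> real) \<Rightarrow> real^'n \<Rightarrow> real" where
  "partial k f u = deriv (\<lambda>t. f (u + t *\<^sub>R axis k 1)) 0"

text \<open>On open \<open>U\<close> this is the usual class of \<open>m\<close> times continuously differentiable functions;
  Frechet differentiability at each stage guarantees that \<open>partial\<close> is an actual derivative.\<close>

primrec Ck_on :: "nat \<Rightarrow> (real^'n::finite) set \<Rightarrow> (real^'n \<Rightarrow> real) \<Rightarrow> bool" where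
  "Ck_on 0 U f \<longleftrightarrow> continuous_on U f"
| "Ck_on (Suc m) U f \<longleftrightarrow> f differentiable_on U \<and> (\<forall>k. Ck_on m U (partial k f))"

definition smooth_on :: "(real^'n::finite) set \<Rightarrow> (real^'n \<Rightarrow> real) \<Rightarrow> bool" where
  "smooth_on U f \<longleftrightarrow> (\<forall>m. Ck_on m U f)"

definition contravariant_metric ::
    "(real^'n::finite) set \<Rightarrow> (real^'n \<Rightarrow> real^'n^'n) \<Rightarrow> bool" where
  "contravariant_metric U g \<longleftrightarrow>
     (\<forall>i j. smooth_on U (\<lambda>u. g u $ i $ j)) \<and>
     (\<forall>u\<in>U. transpose (g u) = g u \<and> det (g u) \<noteq> 0)"

definition lowered :: "(real^'n::finite \<Rightarrow> real^'n^'n) \<Rightarrow> real^'n \<Rightarrow> real^'n^'n" where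
  "lowered g u = matrix_inv (g u)"

text \<open>In all index notation below, \<open>g\<close> is the \<^emph>\<open>contravariant\<close> metric, and upper indices come
  first. \<open>christoffel g i j k\<close> is \<open>\<Gamma>\<^sup>i\<^sub>j\<^sub>k\<close>.\<close>

definition christoffel ::
    "(real^'n::finite \<Rightarrow> real^'n^'n) \<Rightarrow> 'n \<Rightarrow> 'n \<Rightarrow> 'n \<Rightarrow> real^'n \<Rightarrow> real" where
  "christoffel g i j k u =
     (1/2) * (\<Sum>s\<in>UNIV. g u $ i $ s *
        (partial j (\<lambda>x. lowered g x $ s $ k) u + partial k (\<lambda>x. lowered g x $ j $ s) u
         - partial s (\<lambda>x. lowered g x $ j $ k) u))"

text \<open>\<open>\<Gamma>\<^sup>i\<^sup>j\<^sub>k\<close>\<close>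

definition contra_christoffel ::
    "(real^'n::finite \<Rightarrow> real^'n^'n) \<Rightarrow> 'n \<Rightarrow> 'n \<Rightarrow> 'n \<Rightarrow> real^'n \<Rightarrow> real" where
  "contra_christoffel g i j k u = (\<Sum>s\<in>UNIV. g u $ i $ s * christoffel g j s k u)"

text \<open>\<open>R\<^sup>i\<^sub>j\<^sub>k\<^sub>l\<close>\<close>

definition riemann ::
    "(real^'n::finite \<Rightarrow> real^'n^'n) \<Rightarrow> 'n \<Rightarrow> 'n \<Rightarrow> 'n \<Rightarrow> 'n \<Rightarrow> real^'n \<Rightarrow> real" where
  "riemann g i j k l u =
     partial k (christoffel g i j l) u - partial l (christoffel g i j k) u
     + (\<Sum>p\<in>UNIV. christoffel g i p k u * christoffel g p j l u)
     - (\<Sum>p\<in>UNIV. christoffel g i p l u * christoffel g p j k u)"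

text \<open>\<open>R\<^sup>i\<^sup>j\<^sub>k\<^sub>l\<close>\<close>

definition contra_riemann ::
    "(real^'n::finite \<Rightarrow> real^'n^'n) \<Rightarrow> 'n \<Rightarrow> 'n \<Rightarrow> 'n \<Rightarrow> 'n \<Rightarrow> real^'n \<Rightarrow> real" where
  "contra_riemann g i j k l u = (\<Sum>s\<in>UNIV. g u $ i $ s * riemann g j s k l u)"

definition lin_comb :: "real \<Rightarrow> (real^'n::finite \<Rightarrow> real^'n^'n) \<Rightarrow> real \<Rightarrow> (real^'n \<Rightarrow> real^'n^'n)
    \<Rightarrow> real^'n \<Rightarrow> real^'n^'n" where
  "lin_comb a g b h u = a *\<^sub>R g u + b *\<^sub>R h u"

text \<open>A combination whose determinant is not identically zero may still degenerate on part of
  \<open>U\<close>. Its connection and curvature, and hence the identities, only make sense where the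
  determinant is nonzero.\<close>

definition almost_compatible ::
    "(real^'n::finite) set \<Rightarrow> (real^'n \<Rightarrow> real^'n^'n) \<Rightarrow> (real^'n \<Rightarrow> real^'n^'n) \<Rightarrow> bool" where
  "almost_compatible U g1 g2 \<longleftrightarrow>
     (\<forall>a b. (\<exists>u\<in>U. det (lin_comb a g1 b g2 u) \<noteq> 0) \<longrightarrow>
        (\<forall>u\<in>U. det (lin_comb a g1 b g2 u) \<noteq> 0 \<longrightarrow>
          (\<forall>i j k. contra_christoffel (lin_comb a g1 b g2) i j k u =
             a * contra_christoffel g1 i j k u + b * contra_christoffel g2 i j k u)))"

definition compatible ::
    "(real^'n::finite) set \<Rightarrow> (real^'n \<Rightarrow> real^'n^'n) \<Rightarrow> (real^'n \<Rightarrow> real^'n^'n) \<Rightarrow> bool" where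
  "compatible U g1 g2 \<longleftrightarrow>
     (\<forall>a b. (\<exists>u\<in>U. det (lin_comb a g1 b g2 u) \<noteq> 0) \<longrightarrow>
        (\<forall>u\<in>U. det (lin_comb a g1 b g2 u) \<noteq> 0 \<longrightarrow>
          (\<forall>i j k. contra_christoffel (lin_comb a g1 b g2) i j k u =
             a * contra_christoffel g1 i j k u + b * contra_christoffel g2 i j k u) \<and>
          (\<forall>i j k l. contra_riemann (lin_comb a g1 b g2) i j k l u =
             a * contra_riemann g1 i j k l u + b * contra_riemann g2 i j k l u)))"

text \<open>\<open>v\<^sup>i\<^sub>j = g\<^sub>1\<^sup>i\<^sup>s g\<^sub>2\<^sub>,\<^sub>s\<^sub>j\<close>\<close>

definition pair_affinor ::
    "(real^'n::finite \<Rightarrow> real^'n^'n) \<Rightarrow> (real^'n \<Rightarrow> real^'n^'n) \<Rightarrow> real^'n \<Rightarrow> real^'n^'n" where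
  "pair_affinor g1 g2 u = g1 u ** lowered g2 u"

text \<open>\<open>N\<^sup>k\<^sub>i\<^sub>j\<close> of \<open>v\<^sup>i\<^sub>j = v u $ i $ j\<close>\<close>

definition nijenhuis ::
    "(real^'n::finite \<Rightarrow> real^'n^'n) \<Rightarrow> 'n \<Rightarrow> 'n \<Rightarrow> 'n \<Rightarrow> real^'n \<Rightarrow> real" where
  "nijenhuis v k i j u =
     (\<Sum>s\<in>UNIV. v u $ s $ i * partial s (\<lambda>x. v x $ k $ j) u
              - v u $ s $ j * partial s (\<lambda>x. v x $ k $ i) u
              + v u $ k $ s * partial j (\<lambda>x. v x $ s $ i) u
              - v u $ k $ s * partial i (\<lambda>x. v x $ s $ j) u)"

definition nijenhuis_vanishes ::
    "(real^'n::finite) set \<Rightarrow> (real^'n \<Rightarrow> real^'n^'n) \<Rightarrow> bool" where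
  "nijenhuis_vanishes U v \<longleftrightarrow> (\<forall>u\<in>U. \<forall>k i j. nijenhuis v k i j u = 0)"

text \<open>For indefinite metrics the roots can be non-real, so they are taken in the complex numbers.
  Where \<open>g2\<close> is nondegenerate the equation has degree \<open>N\<close>, and its roots are distinct when there
  are \<open>N\<close> different ones.\<close>

definition nonsingular_pair ::
    "(real^'n::finite) set \<Rightarrow> (real^'n \<Rightarrow> real^'n^'n) \<Rightarrow> (real^'n \<Rightarrow> real^'n^'n) \<Rightarrow> bool" where
  "nonsingular_pair U g1 g2 \<longleftrightarrow>
     (\<forall>u\<in>U. card {z::complex. det (\<chi> i j. complex_of_real (g1 u $ i $ j)
                                    - z * complex_of_real (g2 u $ i $ j)) = 0} = CARD('n))"

end

theory Submission
  imports Defs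
begin

text \<open>Everything is pointwise and needs no adapted coordinates. Let \<open>C\<close>, \<open>C'\<close> be the Levi-Civita
  connections of \<open>g\<close> and \<open>h\<close>, and let \<open>T = C' - C\<close>. The family \<open>\<Gamma>\<^sup>i\<^sup>j\<^sub>k\<close> of \<open>a g + b h\<close> is determined by
  metricity, which is linear in the metric, and by vanishing torsion, which is quadratic; its mixed
  part says exactly that \<open>T(v x, y) = T(x, v y)\<close>. Expressing \<open>\<partial>v\<close> through \<open>C\<close>, \<open>C'\<close> turns the Nijenhuis
  tensor into a combination of \<open>S(x, y) = T(v x, y) - T(x, v y)\<close> and its adjoints, which vanishes
  only if \<open>S = 0\<close>. So almost compatibility and vanishing of the Nijenhuis tensor are equivalent,
  even for singular pairs.

  For the curvature, \<open>R\<^sup>i\<^sup>j\<^sub>k\<^sub>l\<close> is linear in first derivatives of \<open>\<Gamma>\<^sup>i\<^sup>j\<^sub>k\<close> up to the term \<open>C\<^sub>k g C\<^sub>l\<^sup>T\<close>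
  antisymmetrised in \<open>k\<close>, \<open>l\<close>. Its deviation from linearity is a
  product of matrices in the commutant of \<open>v\<close>, which is commutative when \<open>v\<close> has distinct complex
  eigenvalues.\<close>

section \<open>Matrix fields and their derivatives\<close>

lemma matrix_mul_uminus_left: "(- A) ** B = - (A ** (B::real^'k^'n))"
  for A :: "real^'n^'m"
  by (simp add: matrix_matrix_mult_def vec_eq_iff sum_negf)

lemma matrix_mul_uminus_right: "A ** (- B) = - (A ** (B::real^'k^'n))"
  for A :: "real^'n^'m"
  by (simp add: matrix_matrix_mult_def vec_eq_iff sum_negf)

lemma matrix_diff_ldistrib: "A ** (B - C) = A ** B - A ** (C::real^'k^'n)"
  for A :: "real^'n^'m"
  by (simp add: matrix_matrix_mult_def vec_eq_iff sum_subtractf right_diff_distrib)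

lemma matrix_diff_rdistrib: "(A - B) ** C = A ** C - B ** (C::real^'k^'n)"
  for A :: "real^'n^'m"
  by (simp add: matrix_matrix_mult_def vec_eq_iff sum_subtractf left_diff_distrib)

lemma matrix_add_rdistrib: "(A + B) ** C = A ** C + B ** (C::real^'k^'n)"
  for A :: "real^'n^'m"
  by (simp add: matrix_matrix_mult_def vec_eq_iff sum.distrib distrib_right)

lemma matrix_mul_scaleR_left: "(c *\<^sub>R A) ** B = c *\<^sub>R (A ** (B::real^'k^'n))"
  for A :: "real^'n^'m"
  by (simp add: matrix_matrix_mult_def vec_eq_iff sum_distrib_left mult.assoc)

lemma matrix_mul_scaleR_right: "A ** (c *\<^sub>R B) = c *\<^sub>R (A ** (B::real^'k^'n))"
  for A :: "real^'n^'m"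
  by (simp add: matrix_matrix_mult_def vec_eq_iff sum_distrib_left mult.left_commute)

lemma transpose_add: "transpose (A + B) = transpose A + transpose (B::real^'n^'m)"
  by (simp add: transpose_def vec_eq_iff)

lemma transpose_diff: "transpose (A - B) = transpose A - transpose (B::real^'n^'m)"
  by (simp add: transpose_def vec_eq_iff)

lemma transpose_uminus: "transpose (- A) = - transpose (A::real^'n^'m)"
  by (simp add: transpose_def vec_eq_iff)

lemmas mat_ring = matrix_mul_assoc matrix_add_ldistrib matrix_add_rdistrib
  matrix_diff_ldistrib matrix_diff_rdistrib matrix_mul_uminus_left matrix_mul_uminus_right
  matrix_mul_scaleR_left matrix_mul_scaleR_right
  transpose_add transpose_diff transpose_uminus transpose_scalar matrix_transpose_mul

lemma bounded_bilinear_matrix_matrix_mult: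
  "bounded_bilinear ((**) :: real^'n^'m \<Rightarrow> real^'k^'n \<Rightarrow> real^'k^'m)"
  by (auto simp: bilinear_conv_bounded_bilinear[symmetric] bilinear_def
      matrix_add_ldistrib matrix_add_rdistrib matrix_mul_scaleR_left matrix_mul_scaleR_right
      intro!: linearI)

lemmas has_derivative_matrix_mul = bounded_bilinear.FDERIV[OF bounded_bilinear_matrix_matrix_mult]

lemma differentiable_matrix_mul:
  fixes A :: "'a::real_normed_vector \<Rightarrow> real^'n^'m" and B :: "'a \<Rightarrow> real^'k^'n"
  assumes "A differentiable (at u)" "B differentiable (at u)"
  shows "(\<lambda>x. A x ** B x) differentiable (at u)"
  using assms bounded_bilinear.FDERIV[OF bounded_bilinear_matrix_matrix_mult]
  unfolding differentiable_def by blast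

lemma linear_transpose: "linear (transpose :: real^'n^'m \<Rightarrow> real^'m^'n)"
  by (intro linearI) (simp_all add: transpose_add transpose_scalar)

lemmas bounded_linear_transpose = linear_conv_bounded_linear[THEN iffD1, OF linear_transpose]

lemma bounded_linear_entry: "bounded_linear (\<lambda>A::real^'n^'m. A $ i $ j)"
  by (simp add: linear_conv_bounded_linear[symmetric] linearI)

section \<open>Differentiability of matrix fields, determinants and inverses\<close>

lemma matrix_differentiable_iff:
  fixes A :: "'a::real_normed_vector \<Rightarrow> real^'n^'m"
  shows "A differentiable (at u) \<longleftrightarrow> (\<forall>i j. (\<lambda>x. A x $ i $ j) differentiable (at u))"
  by (subst differentiable_componentwise_within) (simp add: Basis_vec_def inner_axis)

lemma det_differentiable:
  fixes A :: "'a::real_normed_vector \<Rightarrow> real^'n^'n"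
  assumes "A differentiable (at u)"
  shows "(\<lambda>x. det (A x)) differentiable (at u)"
proof -
  have e: "(\<lambda>x. A x $ i $ j) differentiable (at u)" for i j
    using assms matrix_differentiable_iff by blast
  have "(\<lambda>x. \<Prod>i\<in>UNIV. A x $ i $ p i) differentiable (at u)" for p
    using e[unfolded frechet_derivative_works]
    by (intro differentiableI[OF has_derivative_prod]) blast
  then show ?thesis unfolding det_def
    by (intro differentiable_sum ballI differentiable_mult differentiable_const) simp_all
qed

lemma matrix_inv_inverse:
  fixes A :: "real^'n^'n"
  assumes "det A \<noteq> 0"
  shows "A ** matrix_inv A = mat 1" "matrix_inv A ** A = mat 1"
  using someI_ex[of "\<lambda>B. A ** B = mat 1 \<and> B ** A = mat 1"] assms
  by (simp_all add: invertible_det_nz[symmetric] invertible_def matrix_inv_def)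

lemma matrix_inv_cramer:
  fixes A :: "real^'n^'n"
  assumes "det A \<noteq> 0"
  shows "matrix_inv A $ k $ j = det (\<chi> i m. if m = k then axis j 1 $ i else A $ i $ m) / det A"
proof -
  have "A *v (matrix_inv A *v axis j 1) = axis j 1"
    by (simp add: matrix_vector_mul_assoc matrix_inv_inverse[OF assms])
  then have "matrix_inv A *v axis j 1 = (\<chi> k. det (\<chi> i m. if m = k then axis j 1 $ i else A $ i $ m) / det A)"
    using cramer[OF assms] by blast
  then show ?thesis
    by (simp add: matrix_vector_mult_basis column_def vec_eq_iff)
qed

text \<open>By Cramer's rule each entry of the inverse is a quotient of determinants of
  differentiable matrices. The rule is transferred as an identity of functions near
  \<open>u\<close>, hence nonvanishing on an open set.\<close>

lemma matrix_inv_differentiable: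
  fixes A :: "'a::real_normed_vector \<Rightarrow> real^'n^'n"
  assumes U: "open U" "u \<in> U" and nz: "\<And>x. x \<in> U \<Longrightarrow> det (A x) \<noteq> 0" and A: "A differentiable (at u)"
  shows "(\<lambda>x. matrix_inv (A x)) differentiable (at u)"
proof -
  have "(\<lambda>x. matrix_inv (A x) $ k $ j) differentiable (at u)" for k j
  proof -
    have "(\<lambda>x. (\<chi> i m. if m = k then axis j 1 $ i else A x $ i $ m)::real^'n^'n) differentiable (at u)"
      unfolding matrix_differentiable_iff vec_lambda_beta
    proof (intro allI)
      fix i m
      show "(\<lambda>x. if m = k then axis j 1 $ i else A x $ i $ m) differentiable (at u)"
        using A[unfolded matrix_differentiable_iff] by (cases "m = k") simp_all
    qed
    then have "(\<lambda>x. det (\<chi> i m. if m = k then axis j 1 $ i else A x $ i $ m) / det (A x)) differentiable (at u)"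
      using A nz U by (intro differentiable_divide det_differentiable) auto
    then obtain D where D: "((\<lambda>x. det (\<chi> i m. if m = k then axis j 1 $ i else A x $ i $ m) / det (A x)) has_derivative D) (at u)"
      unfolding differentiable_def by blast
    have "((\<lambda>x. matrix_inv (A x) $ k $ j) has_derivative D) (at u)"
      by (rule has_derivative_transform_within_open[OF D U]) (simp add: matrix_inv_cramer nz)
    then show ?thesis unfolding differentiable_def by blast
  qed
  then show ?thesis using matrix_differentiable_iff by blast
qed

section \<open>Partial derivatives of matrix fields\<close>

definition partial_mat :: "'n \<Rightarrow> (real^'n::finite \<Rightarrow> real^'n^'n) \<Rightarrow> real^'n \<Rightarrow> real^'n^'n" where
  "partial_mat k A u = (\<chi> i j. partial k (\<lambda>x. A x $ i $ j) u)"

text \<open>The chain rule along the coordinate line through \<open>u\<close>. It replaces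
  \<open>deriv\<close>, which carries no information unless a derivative exists, by the Frechet
  derivative.\<close>

lemma partial_eq:
  assumes "(f has_derivative D) (at u)"
  shows "partial k f u = D (axis k 1)"
proof -
  have "((\<lambda>t. u + t *\<^sub>R axis k 1) has_derivative (\<lambda>t. t *\<^sub>R axis k 1)) (at (0::real))"
    by (auto intro!: derivative_eq_intros)
  moreover have "(f has_derivative D) (at (u + 0 *\<^sub>R axis k 1))" using assms by simp
  ultimately have "((\<lambda>t. f (u + t *\<^sub>R axis k 1)) has_derivative (\<lambda>t. D (t *\<^sub>R axis k 1))) (at 0)"
    by (rule has_derivative_compose)
  then have "((\<lambda>t. f (u + t *\<^sub>R axis k 1)) has_derivative (\<lambda>t. D (axis k 1) * t)) (at 0)"
    by (simp add: linear_cmul[OF has_derivative_linear[OF assms]] mult.commute)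
  then have "((\<lambda>t. f (u + t *\<^sub>R axis k 1)) has_field_derivative D (axis k 1)) (at 0)"
    by (simp add: has_field_derivative_def)
  then show ?thesis unfolding partial_def by (rule DERIV_imp_deriv)
qed

lemma partial_mat_eq:
  assumes "(A has_derivative D) (at u)"
  shows "partial_mat k A u = D (axis k 1)"
  using partial_eq[OF bounded_linear.has_derivative[OF bounded_linear_entry assms]]
  by (simp add: partial_mat_def vec_eq_iff)

lemma partial_mat_cong_open:
  assumes "open U" "u \<in> U" "A differentiable (at u)" "\<And>x. x \<in> U \<Longrightarrow> A x = B x"
  shows "partial_mat k A u = partial_mat k B u"
proof -
  obtain D where D: "(A has_derivative D) (at u)" using assms by (auto simp: differentiable_def)
  then have "(B has_derivative D) (at u)"
    using has_derivative_transform_within_open[OF D assms(1,2)] assms(4) by blast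
  with D show ?thesis by (simp add: partial_mat_eq)
qed

lemma differentiable_cong_open:
  assumes "open U" "u \<in> U" "A differentiable (at u)" "\<And>x. x \<in> U \<Longrightarrow> A x = B x"
  shows "B differentiable (at u)"
  using assms has_derivative_transform_within_open unfolding differentiable_def by blast

lemma partial_mat_mul:
  assumes "A differentiable (at u)" "B differentiable (at u)"
  shows "partial_mat k (\<lambda>x. A x ** B x) u = partial_mat k A u ** B u + A u ** partial_mat k B u"
proof -
  obtain D E where D: "(A has_derivative D) (at u)" "(B has_derivative E) (at u)"
    using assms unfolding differentiable_def by blast
  show ?thesis
    by (simp add: partial_mat_eq[OF has_derivative_matrix_mul[OF D]] partial_mat_eq[OF D(1)]
        partial_mat_eq[OF D(2)] add.commute)
qed

lemma partial_mat_lin_comb: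
  assumes "A differentiable (at u)" "B differentiable (at u)"
  shows "partial_mat k (\<lambda>x. a *\<^sub>R A x + b *\<^sub>R B x) u = a *\<^sub>R partial_mat k A u + b *\<^sub>R partial_mat k B u"
proof -
  obtain D E where D: "(A has_derivative D) (at u)" "(B has_derivative E) (at u)"
    using assms unfolding differentiable_def by blast
  have "((\<lambda>x. a *\<^sub>R A x + b *\<^sub>R B x) has_derivative (\<lambda>x. a *\<^sub>R D x + b *\<^sub>R E x)) (at u)"
    by (intro derivative_intros D)
  then show ?thesis by (simp add: partial_mat_eq[OF D(1)] partial_mat_eq[OF D(2)] partial_mat_eq)
qed

lemma partial_mat_transpose:
  "partial_mat k (\<lambda>x. transpose (A x)) u = transpose (partial_mat k A u)"
  by (simp add: partial_mat_def transpose_def)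

section \<open>Levi-Civita connection and curvature of a metric\<close>

text \<open>Two orders of differentiability are what the curvature uses. Besides the two given
  metrics, their linear combinations are instances, on the open set where they are
  nondegenerate.\<close>

locale metric_field =
  fixes U :: "(real^'n::finite) set" and g :: "real^'n \<Rightarrow> real^'n^'n"
  assumes open_U: "open U"
    and diff: "\<And>u. u \<in> U \<Longrightarrow> g differentiable (at u)"
    and diff2: "\<And>u k. u \<in> U \<Longrightarrow> partial_mat k g differentiable (at u)"
    and symm: "\<And>u. u \<in> U \<Longrightarrow> transpose (g u) = g u"
    and nondeg: "\<And>u. u \<in> U \<Longrightarrow> det (g u) \<noteq> 0"

text \<open>\<open>connection g k u $ i $ j\<close> is \<open>\<Gamma>\<^sup>i\<^sub>j\<^sub>k\<close> and \<open>contra_connection g k u $ i $ j\<close> is \<open>\<Gamma>\<^sup>i\<^sup>j\<^sub>k\<close>.\<close>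

definition connection :: "(real^'n::finite \<Rightarrow> real^'n^'n) \<Rightarrow> 'n \<Rightarrow> real^'n \<Rightarrow> real^'n^'n" where
  "connection g k u = (\<chi> i j. christoffel g i j k u)"

lemma contra_christoffel_eq:
  "contra_christoffel g i j k u = (g u ** transpose (connection g k u)) $ i $ j"
  by (simp add: contra_christoffel_def matrix_matrix_mult_def connection_def transpose_def)

context metric_field
begin

lemma inverse: "u \<in> U \<Longrightarrow> g u ** lowered g u = mat 1" "u \<in> U \<Longrightarrow> lowered g u ** g u = mat 1"
  using nondeg by (simp_all add: lowered_def matrix_inv_inverse)

lemma lowered_symm: assumes "u \<in> U" shows "transpose (lowered g u) = lowered g u"
proof -
  have "transpose (lowered g u) ** g u = mat 1"
    using arg_cong[OF inverse(1)[OF assms], of transpose] symm[OF assms] by (simp add: matrix_transpose_mul)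
  then have "transpose (lowered g u) ** (g u ** lowered g u) = lowered g u"
    by (simp add: matrix_mul_assoc)
  then show ?thesis using inverse assms by simp
qed

lemma lowered_diff: "u \<in> U \<Longrightarrow> lowered g differentiable (at u)"
  using matrix_inv_differentiable[OF open_U _ nondeg diff] by (simp add: lowered_def[abs_def])

lemma partial_lowered_mul:
  assumes "u \<in> U"
  shows "partial_mat k g u ** lowered g u + g u ** partial_mat k (lowered g) u = 0"
proof -
  have "partial_mat k (\<lambda>x. g x ** lowered g x) u = partial_mat k (\<lambda>x. mat 1) u"
    using assms lowered_diff diff inverse open_U
    by (intro partial_mat_cong_open[where U=U]) (auto intro: differentiable_matrix_mul)
  also have "\<dots> = 0" by (rule partial_mat_eq) (rule has_derivative_const)
  finally show ?thesis using assms by (simp add: partial_mat_mul lowered_diff diff)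
qed

lemma partial_lowered:
  assumes "u \<in> U"
  shows "partial_mat k (lowered g) u = - (lowered g u ** partial_mat k g u ** lowered g u)"
proof -
  have "lowered g u ** (g u ** partial_mat k (lowered g) u) = lowered g u ** - (partial_mat k g u ** lowered g u)"
    using partial_lowered_mul[OF assms, of k] by (metis add.commute add_eq_0_iff)
  then show ?thesis using assms by (simp add: mat_ring inverse)
qed

lemma partial_eq_lowered:
  assumes "u \<in> U"
  shows "partial_mat k g u = - (g u ** partial_mat k (lowered g) u ** g u)"
proof -
  have "partial_mat k g u = g u ** lowered g u ** partial_mat k g u ** (lowered g u ** g u)"
    using assms by (simp add: inverse)
  then show ?thesis by (simp add: partial_lowered assms mat_ring)
qed

text \<open>The formula \<open>partial_lowered\<close> holds on all of \<open>U\<close>, which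
  reduces the second derivatives of the inverse to those of \<open>g\<close>.\<close>

lemma partial_lowered_diff:
  assumes "u \<in> U" shows "partial_mat k (lowered g) differentiable (at u)"
proof (rule differentiable_cong_open[OF open_U assms])
  show "(\<lambda>u. - (lowered g u ** partial_mat k g u ** lowered g u)) differentiable (at u)"
    using assms by (intro differentiable_minus differentiable_matrix_mul lowered_diff diff2)
qed (simp add: partial_lowered)

lemma partial_lowered_symm:
  assumes "u \<in> U"
  shows "partial_mat k (lowered g) u $ i $ j = partial_mat k (lowered g) u $ j $ i"
proof -
  have "partial_mat k (lowered g) u = partial_mat k (\<lambda>x. transpose (lowered g x)) u"
    using assms open_U lowered_symm lowered_diff by (intro partial_mat_cong_open[where U=U]) auto
  then have "transpose (partial_mat k (lowered g) u) = partial_mat k (lowered g) u"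
    unfolding partial_mat_transpose by (rule sym)
  then show ?thesis by (simp add: transpose_def vec_eq_iff)
qed

lemma connection_eq:
  "connection g k u = g u ** (\<chi> s j. (1/2) * (partial_mat j (lowered g) u $ s $ k
     + partial_mat k (lowered g) u $ j $ s - partial_mat s (lowered g) u $ j $ k))"
  by (simp add: connection_def christoffel_def matrix_matrix_mult_def vec_eq_iff partial_mat_def
      sum_distrib_left mult.left_commute)

lemma connection_symm:
  assumes "u \<in> U" shows "connection g k u $ i $ j = connection g j u $ i $ k"
proof -
  have "christoffel g i j k u = christoffel g i k j u"
    using partial_lowered_symm[OF assms]
    by (simp add: christoffel_def partial_mat_def algebra_simps)
  then show ?thesis by (simp add: connection_def)
qed

lemma connection_diff:
  assumes "u \<in> U" shows "connection g k differentiable (at u)"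
proof -
  have *: "(\<lambda>u. partial_mat j (lowered g) u $ s $ p) differentiable (at u)" for j s p
    using partial_lowered_diff[OF assms] matrix_differentiable_iff by blast
  show ?thesis unfolding connection_eq[abs_def]
  proof (rule differentiable_matrix_mul[OF diff[OF assms]])
    show "(\<lambda>u. \<chi> s j. (1/2) * (partial_mat j (lowered g) u $ s $ k
     + partial_mat k (lowered g) u $ j $ s - partial_mat s (lowered g) u $ j $ k)) differentiable (at u)"
      unfolding matrix_differentiable_iff vec_lambda_beta
      by (intro allI differentiable_mult differentiable_const differentiable_add differentiable_diff *)
  qed
qed

text \<open>The connection is \<open>g\<close> times the symbols of the first kind \<open>K\<close>,
  and the symmetric part of \<open>K\<close> is half the derivative of the lowered metric. Raising
  indices with \<open>partial_eq_lowered\<close> gives the formula.\<close>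

lemma connection_metric:
  assumes "u \<in> U"
  shows "partial_mat k g u = - (connection g k u ** g u) - g u ** transpose (connection g k u)"
proof -
  define K where "K = (\<chi> s j. (1/2) * (partial_mat j (lowered g) u $ s $ k
     + partial_mat k (lowered g) u $ j $ s - partial_mat s (lowered g) u $ j $ k))"
  have C: "connection g k u = g u ** K"
    by (simp add: connection_eq K_def)
  have "partial_mat k (lowered g) u = K + transpose K"
    using partial_lowered_symm[OF assms] by (simp add: K_def transpose_def vec_eq_iff field_simps)
  then show ?thesis
    unfolding partial_eq_lowered[OF assms] C by (simp add: symm[OF assms] mat_ring)
qed

end

section \<open>The curvature in matrix form\<close>

lemma transpose_differentiable:
  fixes A :: "'a::real_normed_vector \<Rightarrow> real^'n^'m"
  assumes "A differentiable (at u)"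
  shows "(\<lambda>x. transpose (A x)) differentiable (at u)"
  using assms bounded_linear.has_derivative[OF bounded_linear_transpose]
  unfolding differentiable_def by blast

lemma riemann_eq:
  "riemann g i j k l u = (partial_mat k (connection g l) u - partial_mat l (connection g k) u
     + connection g k u ** connection g l u - connection g l u ** connection g k u) $ i $ j"
  by (simp add: riemann_def partial_mat_def connection_def matrix_matrix_mult_def)

lemma contra_riemann_transpose:
  "contra_riemann g i j k l u = (g u ** transpose (partial_mat k (connection g l) u
     - partial_mat l (connection g k) u
     + connection g k u ** connection g l u - connection g l u ** connection g k u)) $ i $ j"
  by (simp add: contra_riemann_def riemann_eq matrix_matrix_mult_def[of "g u"] transpose_def)

definition contra_connection :: "(real^'n::finite \<Rightarrow> real^'n^'n) \<Rightarrow> 'n \<Rightarrow> real^'n \<Rightarrow> real^'n^'n" where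
  "contra_connection g k u = g u ** transpose (connection g k u)"

context metric_field
begin

lemma contra_connection_diff: "u \<in> U \<Longrightarrow> contra_connection g k differentiable (at u)"
  unfolding contra_connection_def[abs_def]
  by (intro differentiable_matrix_mul diff transpose_differentiable connection_diff)

text \<open>Differentiate \<open>g ** transpose (connection g l u)\<close> and insert metricity for
  the derivative of \<open>g\<close>: the terms with \<open>g\<close> on the far left cancel the
  products of connections in the curvature. What remains is linear in derivatives of
  \<open>contra_connection\<close>, apart from one quadratic term, which \<open>quadratic_F\<close>
  compares later.\<close>

lemma contra_riemann_eq:
  assumes "u \<in> U"
  shows "contra_riemann g i j k l u =
     (partial_mat k (contra_connection g l) u - partial_mat l (contra_connection g k) u
      + connection g k u ** g u ** transpose (connection g l u)
      - connection g l u ** g u ** transpose (connection g k u)) $ i $ j"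
proof -
  have P: "partial_mat k (contra_connection g l) u =
      (- (connection g k u ** g u) - g u ** transpose (connection g k u)) ** transpose (connection g l u)
      + g u ** transpose (partial_mat k (connection g l) u)" for k l
    unfolding contra_connection_def[abs_def] using assms
    by (simp add: partial_mat_mul diff transpose_differentiable connection_diff
        partial_mat_transpose connection_metric)
  show ?thesis
    unfolding contra_riemann_transpose P
    by (simp add: mat_ring)
qed

end

section \<open>Families of matrices indexed by coordinate directions\<close>

definition along :: "('n \<Rightarrow> real^'n^'n) \<Rightarrow> real^'n::finite \<Rightarrow> real^'n^'n" where
  "along M x = (\<Sum>k\<in>UNIV. x $ k *\<^sub>R M k)"

text \<open>Fixing the upper index leaves a bilinear form in the two lower ones. Symmetry in the
  lower indices becomes symmetry of a matrix.\<close>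

definition slice :: "('n \<Rightarrow> real^'n^'n) \<Rightarrow> 'n::finite \<Rightarrow> real^'n^'n" where
  "slice M i = (\<chi> k p. M k $ i $ p)"

text \<open>For the matrices of a connection this is vanishing torsion.\<close>

definition sym_family :: "('n \<Rightarrow> real^'n^'n) \<Rightarrow> bool" where
  "sym_family M \<longleftrightarrow> (\<forall>i j k. M k $ i $ j = M j $ i $ k)"

lemma sym_family_slice: "sym_family M \<longleftrightarrow> (\<forall>i. transpose (slice M i) = slice M i)"
  by (auto simp: sym_family_def slice_def transpose_def vec_eq_iff)

lemma along_nth: "along M x $ i $ j = (\<Sum>k\<in>UNIV. x $ k * M k $ i $ j)"
  by (simp add: along_def)

lemma along_axis: "along M (axis k 1) = M k"
  by (simp add: along_def axis_def if_distrib if_distribR cong: if_cong)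

lemma along_slice: "(along M x *v y) $ i = x \<bullet> (slice M i *v y)"
proof -
  have "(along M x *v y) $ i = (\<Sum>j\<in>UNIV. \<Sum>k\<in>UNIV. x $ k * M k $ i $ j * y $ j)"
    by (simp add: matrix_vector_mult_def along_nth sum_distrib_right)
  also have "\<dots> = (\<Sum>k\<in>UNIV. \<Sum>j\<in>UNIV. x $ k * M k $ i $ j * y $ j)"
    by (rule sum.swap)
  also have "\<dots> = x \<bullet> (slice M i *v y)"
    by (simp add: matrix_vector_mult_def slice_def inner_vec_def sum_distrib_left mult.assoc)
  finally show ?thesis .
qed

lemma along_commute:
  assumes "sym_family M"
  shows "along M x *v y = along M y *v x"
proof -
  have "x \<bullet> (slice M i *v y) = y \<bullet> (slice M i *v x)" for i
    using assms unfolding sym_family_slice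
    by (metis dot_lmul_matrix inner_commute transpose_matrix_vector)
  then show ?thesis by (simp add: vec_eq_iff along_slice)
qed

lemma along_add: "along (\<lambda>k. M k + N k) x = along M x + along N x"
  by (simp add: along_def scaleR_add_right sum.distrib)

lemma along_diff: "along (\<lambda>k. M k - N k) x = along M x - along N x"
  by (simp add: along_def scaleR_diff_right sum_subtractf)

lemma along_mul_left: "along (\<lambda>k. A ** M k) x = A ** along M x"
  unfolding along_def
  by (simp add: bounded_bilinear.sum_right[OF bounded_bilinear_matrix_matrix_mult] matrix_mul_scaleR_right)

lemma along_mul_right: "along (\<lambda>k. M k ** A) x = along M x ** A"
  unfolding along_def
  by (simp add: bounded_bilinear.sum_left[OF bounded_bilinear_matrix_matrix_mult] matrix_mul_scaleR_left)

lemma along_transpose: "along (\<lambda>k. transpose (M k)) x = transpose (along M x)"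
  unfolding along_def by (simp add: linear_sum[OF linear_transpose] transpose_scalar)

lemma slice_lin_comb_mul: "slice (\<lambda>k. M k + b *\<^sub>R (N k ** w)) i = slice M i + b *\<^sub>R (slice N i ** w)"
  by (simp add: slice_def matrix_matrix_mult_def vec_eq_iff)

text \<open>Lowering the free index makes the difference of the two families symmetric in one pair of
  indices and antisymmetric in another.\<close>

lemma levi_civita_unique:
  fixes g :: "real^'n^'n::finite"
  assumes C: "sym_family C" and F: "sym_family F"
    and g: "transpose g = g" "g ** l = mat 1" "l ** g = mat 1"
    and eq: "\<And>k. C k ** g + g ** transpose (C k) = F k ** g + g ** transpose (F k)"
  shows "C k = F k"
proof -
  define E where "E k = l ** (F k - C k)" for k
  have l: "transpose l = l"
    using g by (metis matrix_mul_assoc matrix_mul_lid matrix_mul_rid matrix_transpose_mul transpose_mat)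
  have "E k + transpose (E k) = 0" for k
  proof -
    have "l ** ((F k - C k) ** g + g ** transpose (F k - C k)) ** l = 0"
      using eq[of k] by (simp add: mat_ring algebra_simps)
    also have "l ** ((F k - C k) ** g + g ** transpose (F k - C k)) ** l
      = l ** (F k - C k) ** (g ** l) + (l ** g) ** transpose (F k - C k) ** l"
      by (simp only: matrix_add_ldistrib matrix_add_rdistrib matrix_mul_assoc)
    finally show ?thesis by (simp add: E_def matrix_transpose_mul l g)
  qed
  then have anti: "E k $ p $ j = - E k $ j $ p" for k p j
    by (simp add: vec_eq_iff transpose_def eq_neg_iff_add_eq_0)
  have sym: "E k $ p $ j = E j $ p $ k" for k p j
    using C F by (simp add: E_def matrix_matrix_mult_def sym_family_def)
  \<comment> \<open>Alternating \<open>sym\<close> and \<open>anti\<close>, three times each,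
    returns to the same entry with the opposite sign.\<close>
  have "E k $ p $ j = 0" for p j
    using anti[of k p j] sym[of k j p] anti[of p j k] sym[of p k j] anti[of j k p] sym[of j p k]
    by linarith
  then have "g ** E k = 0" by (simp add: vec_eq_iff matrix_matrix_mult_def)
  then show ?thesis by (simp add: E_def matrix_mul_assoc g)
qed

section \<open>The commutant of a matrix with distinct eigenvalues\<close>

text \<open>Applying \<open>M\<close> minus \<open>z m\<close> to a vanishing combination removes
  the term \<open>m\<close> and multiplies every other coefficient by a nonzero difference of
  eigenvalues, so induction on \<open>S\<close> applies.\<close>

lemma eigenvectors_independent:
  fixes M :: "'a::field^'n^'n::finite" and S :: "'i set"
  assumes z: "inj z" and e: "\<And>i. e i \<noteq> 0" "\<And>i. M *v e i = z i *s e i" and "finite S"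
  shows "(\<Sum>i\<in>S. c i *s e i) = 0 \<Longrightarrow> i \<in> S \<Longrightarrow> c i = 0"
  using \<open>finite S\<close>
proof (induction S arbitrary: c i)
  case (insert m S)
  have "(\<Sum>i\<in>insert m S. (c i * (z i - z m)) *s e i) = M *v (\<Sum>i\<in>insert m S. c i *s e i) - z m *s (\<Sum>i\<in>insert m S. c i *s e i)"
    unfolding vec.linear_sum[OF matrix_vector_mul_linear_gen] vec.scale_sum_right sum_subtractf[symmetric]
    by (rule sum.cong) (simp_all add: vec.scale e vector_scalar_commute vec_eq_iff algebra_simps)
  also have "\<dots> = 0" using insert.prems(1) by simp
  finally have "(\<Sum>i\<in>S. (c i * (z i - z m)) *s e i) = 0" using insert.hyps by simp
  then have S: "c i = 0" if "i \<in> S" for i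
    using insert.IH[of "\<lambda>i. c i * (z i - z m)" i] that insert.hyps z by (auto dest: injD)
  then have "c m *s e m = 0" using insert.prems(1) insert.hyps by simp
  then have "c m = 0" using e(1) by (simp add: vec_eq_iff) (metis e(1) vec_eq_iff zero_index)
  with S insert.prems(2) show ?case by auto
qed simp

lemma diagonal_of_commute:
  fixes A D :: "'a::field^'n^'n::finite"
  assumes "inj z" "D = (\<chi> i j. if i = j then z i else 0)" "A ** D = D ** A" "i \<noteq> j"
  shows "A $ i $ j = 0"
proof -
  have "(A ** D) $ i $ j = A $ i $ j * z j" "(D ** A) $ i $ j = z i * A $ i $ j"
    by (simp_all add: assms(2) matrix_matrix_mult_def if_distrib if_distribR cong: if_cong)
  then have "A $ i $ j * z j = z i * A $ i $ j" using assms(3) by metis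
  then have "A $ i $ j * (z j - z i) = 0" by (simp only: right_diff_distrib) (simp add: mult.commute)
  then show ?thesis using assms(1,4) by (auto dest: injD)
qed

text \<open>The eigenvectors form the columns of an invertible \<open>E\<close>. Conjugation by
  \<open>E\<close> makes \<open>M\<close> diagonal with distinct entries, so everything commuting
  with \<open>M\<close> becomes diagonal, and diagonal matrices commute.\<close>

lemma commutant_commutative:
  fixes M :: "'a::field^'n^'n::finite" and z :: "'n \<Rightarrow> 'a"
  assumes z: "inj z" and e: "\<And>i. e i \<noteq> 0" "\<And>i. M *v e i = z i *s e i"
    and A: "A ** M = M ** A" and B: "B ** M = M ** B"
  shows "A ** B = B ** A"
proof -
  define E where "E = (\<chi> r i. e i $ r)"
  define D where "D = (\<chi> i j. if i = j then z i else 0)"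
  have Ex: "E *v c = (\<Sum>i\<in>UNIV. c $ i *s e i)" for c
    by (simp add: E_def matrix_vector_mult_def vec_eq_iff mult.commute)
  have "c = 0" if "E *v c = 0" for c
  proof -
    have "c $ i = 0" for i
      using eigenvectors_independent[OF z e, of UNIV "\<lambda>i. c $ i" i] that unfolding Ex by simp
    then show ?thesis by (simp add: vec_eq_iff)
  qed
  then have "\<exists>W. W ** E = mat 1" unfolding matrix_left_invertible_ker by simp
  then obtain W where WE: "W ** E = mat 1" ..
  then have EW: "E ** W = mat 1" by (simp add: matrix_left_right_inverse)
  have "(M ** E) $ r $ i = (E ** D) $ r $ i" for r i
  proof -
    have "(M ** E) $ r $ i = (M *v e i) $ r"
      by (simp add: E_def matrix_matrix_mult_def matrix_vector_mult_def)
    then show ?thesis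
      by (simp add: e E_def D_def matrix_matrix_mult_def if_distrib if_distribR mult.commute cong: if_cong)
  qed
  then have ME: "M ** E = E ** D" by (simp add: vec_eq_iff)
  have WM: "W ** M = D ** W"
  proof -
    have "W ** M ** (E ** W) = W ** (M ** E) ** W" by (simp add: matrix_mul_assoc)
    also have "\<dots> = (W ** E) ** D ** W" by (simp add: ME matrix_mul_assoc)
    finally show ?thesis by (simp add: WE EW)
  qed
  have diag: "(W ** X ** E) $ i $ j = 0" if "X ** M = M ** X" "i \<noteq> j" for X i j
  proof (rule diagonal_of_commute[OF z D_def _ \<open>i \<noteq> j\<close>])
    have "W ** X ** E ** D = W ** (X ** M) ** E" by (simp add: ME matrix_mul_assoc[symmetric])
    also have "\<dots> = (W ** M) ** X ** E" by (simp add: that matrix_mul_assoc)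
    finally show "W ** X ** E ** D = D ** (W ** X ** E)" by (simp add: WM matrix_mul_assoc)
  qed
  have "(W ** A ** E) ** (W ** B ** E) = (W ** B ** E) ** (W ** A ** E)"
  proof -
    have "(\<Sum>k\<in>UNIV. (W ** A ** E) $ i $ k * (W ** B ** E) $ k $ j)
        = (\<Sum>k\<in>UNIV. (W ** B ** E) $ i $ k * (W ** A ** E) $ k $ j)" for i j
    proof (rule sum.cong)
      fix k show "(W ** A ** E) $ i $ k * (W ** B ** E) $ k $ j
        = (W ** B ** E) $ i $ k * (W ** A ** E) $ k $ j"
        by (cases "i = k"; cases "k = j") (simp_all add: diag A B)
    qed simp
    then show ?thesis
      by (simp add: matrix_matrix_mult_def[of "W ** A ** E" "W ** B ** E"]
          matrix_matrix_mult_def[of "W ** B ** E" "W ** A ** E"])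
  qed
  then have "E ** ((W ** A ** E) ** (W ** B ** E)) ** W = E ** ((W ** B ** E) ** (W ** A ** E)) ** W"
    by simp
  moreover have "E ** ((W ** X ** E) ** (W ** Y ** E)) ** W = X ** Y" for X Y
  proof -
    have "E ** ((W ** X ** E) ** (W ** Y ** E)) ** W = (E ** W) ** X ** (E ** W) ** Y ** (E ** W)"
      by (simp add: matrix_mul_assoc)
    then show ?thesis by (simp add: EW)
  qed
  ultimately show ?thesis by simp
qed

section \<open>Passage to complex matrices\<close>

definition of_real_mat :: "real^'n^'m \<Rightarrow> complex^'n^'m" where
  "of_real_mat A = (\<chi> i j. complex_of_real (A $ i $ j))"

lemma of_real_mat_mul: "of_real_mat (A ** B) = of_real_mat A ** of_real_mat B"
  by (simp add: of_real_mat_def matrix_matrix_mult_def)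

lemma of_real_mat_one: "of_real_mat (mat 1) = mat 1"
  by (simp add: of_real_mat_def mat_def vec_eq_iff)

lemma of_real_mat_inject: "of_real_mat A = of_real_mat B \<longleftrightarrow> A = B"
  by (simp add: of_real_mat_def vec_eq_iff)

text \<open>If \<open>x\<close> is in the kernel of \<open>g - z h\<close>, then \<open>h x\<close>
  is an eigenvector of \<open>g ** l\<close> for \<open>z\<close>, because \<open>l\<close> undoes
  \<open>h\<close>. The roots may be non-real, so the argument runs over the complex numbers and
  returns by injectivity of \<open>of_real_mat\<close>.\<close>

lemma real_commutant_commutative:
  fixes g h l A B :: "real^'n^'n::finite"
  assumes hl: "h ** l = mat 1" "l ** h = mat 1"
    and card: "card {z::complex. det (\<chi> i j. of_real (g $ i $ j) - z * of_real (h $ i $ j)) = 0} = CARD('n)"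
    and A: "A ** (g ** l) = (g ** l) ** A" and B: "B ** (g ** l) = (g ** l) ** B"
  shows "A ** B = B ** A"
proof -
  let ?Z = "{z::complex. det (\<chi> i j. of_real (g $ i $ j) - z * of_real (h $ i $ j)) = 0}"
  \<comment> \<open>An infinite set has \<open>card\<close> 0, while \<open>CARD('n)\<close> is
    positive.\<close>
  have "finite ?Z" using card card.infinite by fastforce
  then obtain z where z: "bij_betw z (UNIV::'n set) ?Z"
    using finite_same_card_bij[of "UNIV::'n set" ?Z] card by auto
  have "\<exists>e. e \<noteq> 0 \<and> of_real_mat (g ** l) *v e = z i *s e" for i
  proof -
    let ?P = "(\<chi> a b. of_real (g $ a $ b) - z i * of_real (h $ a $ b)) :: complex^'n^'n"
    have "det ?P = 0" using z by (auto simp: bij_betw_def)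
    then have "\<not> (\<exists>Q. Q ** ?P = mat 1)"
      using invertible_det_nz[of ?P] by (simp add: invertible_left_inverse)
    then have "\<exists>x. ?P *v x = 0 \<and> x \<noteq> 0" unfolding matrix_left_invertible_ker by simp
    then obtain x where x: "?P *v x = 0" "x \<noteq> 0" by auto
    have gx: "of_real_mat g *v x = z i *s (of_real_mat h *v x)"
      using x(1) by (simp add: of_real_mat_def matrix_vector_mult_def vec_eq_iff left_diff_distrib
          sum_subtractf sum_distrib_left mult.assoc)
    define e where "e = of_real_mat h *v x"
    have le: "of_real_mat l *v e = x"
      by (simp add: e_def matrix_vector_mul_assoc of_real_mat_mul[symmetric] hl of_real_mat_one)
    have "of_real_mat (g ** l) *v e = of_real_mat g *v (of_real_mat l *v e)"
      by (simp add: of_real_mat_mul matrix_vector_mul_assoc)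
    then have "of_real_mat (g ** l) *v e = z i *s e" unfolding le gx e_def[symmetric] .
    moreover have "e \<noteq> 0" using le x(2) by auto
    ultimately show ?thesis by blast
  qed
  then obtain e where e: "\<And>i. e i \<noteq> 0" "\<And>i. of_real_mat (g ** l) *v e i = z i *s e i" by metis
  have "inj z" using z by (simp add: bij_betw_def)
  from commutant_commutative[OF this e, of "of_real_mat A" "of_real_mat B"] show ?thesis
    using A B by (simp add: of_real_mat_mul[symmetric] of_real_mat_inject)
qed

section \<open>Pointwise algebra of a pair of metrics\<close>

text \<open>In terms of the bilinear map \<open>T(x, y)\<close> with coefficients \<open>T k $ i $ p\<close>, \<open>intertwines v T\<close> says
  \<open>T(v x, y) = T(x, v y)\<close>, and \<open>defect v T x *v y\<close> is \<open>T(v x, y) - T(x, v y)\<close>.\<close>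

definition intertwines :: "real^'n^'n \<Rightarrow> ('n::finite \<Rightarrow> real^'n^'n) \<Rightarrow> bool" where
  "intertwines v T \<longleftrightarrow> (\<forall>i. transpose v ** slice T i = slice T i ** v)"

definition defect :: "real^'n^'n \<Rightarrow> ('n::finite \<Rightarrow> real^'n^'n) \<Rightarrow> real^'n \<Rightarrow> real^'n^'n" where
  "defect v T x = along T (v *v x) - along T x ** v"

lemma defect_slice: "(defect v T x *v y) $ i = x \<bullet> ((transpose v ** slice T i - slice T i ** v) *v y)"
proof -
  have "(defect v T x *v y) $ i = (v *v x) \<bullet> (slice T i *v y) - x \<bullet> (slice T i *v (v *v y))"
    by (simp add: defect_def matrix_vector_mult_diff_rdistrib along_slice flip: matrix_vector_mul_assoc)
  also have "(v *v x) \<bullet> (slice T i *v y) = x \<bullet> ((transpose v ** slice T i) *v y)"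
    unfolding matrix_vector_mul_assoc[symmetric]
    by (metis dot_lmul_matrix transpose_matrix_vector transpose_transpose)
  finally show ?thesis
    by (simp add: matrix_vector_mult_diff_rdistrib inner_diff_right matrix_vector_mul_assoc)
qed

lemma inner_axis_mult_axis: "axis k 1 \<bullet> (M *v axis j 1) = M $ k $ j" for M :: "real^'n^'m"
  by (simp only: matrix_vector_mult_basis) (simp add: inner_axis' column_def)

lemma intertwines_iff_defect:
  "intertwines v T \<longleftrightarrow> (\<forall>k j. defect v T (axis k 1) *v axis j 1 = 0)"
proof -
  have "(defect v T (axis k 1) *v axis j 1) $ i = (transpose v ** slice T i - slice T i ** v) $ k $ j" for k j i
    unfolding defect_slice by (rule inner_axis_mult_axis)
  then show ?thesis by (simp add: intertwines_def vec_eq_iff) blast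
qed

text \<open>As \<open>T\<close> is symmetric, exchanging \<open>x\<close> and \<open>y\<close>
  exchanges the two terms of the defect.\<close>

lemma defect_antisym:
  assumes "sym_family T"
  shows "defect v T x *v y = - (defect v T y *v x)"
  by (simp add: defect_def matrix_vector_mult_diff_rdistrib along_commute[OF assms, of "v *v x" y]
      along_commute[OF assms, of x "v *v y"] flip: matrix_vector_mul_assoc)

lemma transpose_mult_inner: "(transpose M *v x) \<bullet> y = x \<bullet> (M *v y)" for M :: "real^'n^'m"
  by (metis dot_lmul_matrix transpose_matrix_vector)

text \<open>If \<open>P\<close> is self-adjoint for the form \<open>B\<close>, so is its inverse:
  multiply by \<open>Q\<close> on the right and by its transpose on the left.\<close>

lemma intertwine_inverse:
  fixes B P Q :: "real^'n^'n"
  assumes "transpose P ** B = B ** P" "P ** Q = mat 1"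
  shows "transpose Q ** B = B ** Q"
proof -
  have "transpose Q ** B = transpose Q ** B ** (P ** Q)" by (simp add: assms)
  also have "\<dots> = transpose Q ** (transpose P ** B) ** Q" by (simp add: assms(1) matrix_mul_assoc)
  also have "\<dots> = transpose (P ** Q) ** B ** Q" by (simp add: matrix_transpose_mul matrix_mul_assoc)
  finally show ?thesis by (simp add: assms)
qed

text \<open>The data at one point: \<open>l\<close> is the inverse of \<open>h\<close>, and
  \<open>C\<close>, \<open>C'\<close> are the values of the connections of \<open>g\<close> and
  \<open>h\<close>.\<close>

locale metric_pair_at =
  fixes g h l :: "real^'n^'n::finite" and C C' :: "'n \<Rightarrow> real^'n^'n"
  assumes gs: "transpose g = g" and hs: "transpose h = h"
    and gd: "det g \<noteq> 0" and hl: "h ** l = mat 1" and lh: "l ** h = mat 1"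
    and Cs: "sym_family C" and Cs': "sym_family C'"
begin

definition v where "v = g ** l"
definition T where "T k = C' k - C k"

lemma ls: "transpose l = l"
  using hs hl lh by (metis matrix_mul_assoc matrix_mul_lid matrix_mul_rid matrix_transpose_mul transpose_mat)

lemma Ts: "sym_family T"
  using Cs Cs' by (simp add: sym_family_def T_def)

lemma vh: "v ** h = g"
  by (simp add: v_def lh flip: matrix_mul_assoc)

lemma hv: "h ** transpose v = g"
  by (simp add: v_def matrix_transpose_mul gs ls hl matrix_mul_assoc)

text \<open>The value of \<open>\<partial>\<^sub>k v\<close> forced by metricity of the two connections.\<close>

definition deriv_v where "deriv_v k = v ** C' k - C k ** v + g ** transpose (T k) ** l"

text \<open>The Nijenhuis tensor of \<open>v\<close> with its lower indices contracted with
  \<open>x\<close> and \<open>y\<close>, and \<open>deriv_v\<close> in place of the derivatives of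
  \<open>v\<close>.\<close>

definition nij where
  "nij x y = along deriv_v (v *v x) *v y - along deriv_v (v *v y) *v x
     + v *v (along deriv_v y *v x) - v *v (along deriv_v x *v y)"

text \<open>Vanishing torsion cancels the terms with \<open>C\<close> at \<open>v x\<close>,
  \<open>v y\<close> and those with \<open>C'\<close> at \<open>x\<close>, \<open>y\<close> under
  two factors \<open>v\<close>; the other connection terms pair up into \<open>T\<close>. The
  identity \<open>vg\<close> turns the remaining terms, those with a transposed \<open>T\<close>,
  into adjoints of the defect.\<close>

lemma nij_eq:
  "nij x y = g *v (l *v (defect v T x *v y) + transpose (defect v T x) *v (l *v y)
      - transpose (defect v T y) *v (l *v x))"
proof -
  have D: "along deriv_v x = v ** along C' x - along C x ** v + g ** transpose (along T x) ** l" for x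
    by (simp add: deriv_v_def[abs_def] along_add along_diff along_mul_left along_mul_right along_transpose)
  have T: "along T x = along C' x - along C x" for x
    by (simp add: T_def[abs_def] along_diff)
  note c = along_commute[OF Cs] and c' = along_commute[OF Cs']
  have vg: "v *v (g *v z) = g *v (transpose v *v z)" for z
    by (metis hv vh matrix_mul_assoc matrix_vector_mul_assoc)
  have gl: "g *v (l *v z) = v *v z" for z by (simp add: v_def matrix_vector_mul_assoc)
  show ?thesis
    unfolding nij_def defect_def D T
    by (simp add: mat_ring algebra_simps gl vg c[of "v *v x" "v *v y"] c'[of "v *v x" y] c'[of "v *v y" x]
        c[of y "v *v x"] c[of x "v *v y"] c'[of y x]
        del: transpose_matrix_vector flip: matrix_vector_mul_assoc matrix_mul_assoc)
qed

text \<open>Lowered with \<open>l\<close>, the defect gives a trilinear \<open>q\<close>, antisymmetric in its first two arguments, and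
  \<open>nij = 0\<close> reads \<open>q(x, y, z) = q(y, z, x) + q(z, x, y)\<close>. Adding the three cyclic
  permutations gives \<open>q = 0\<close>.\<close>

lemma nij_eq_0_iff: "(\<forall>i j. nij (axis i 1) (axis j 1) = 0) \<longleftrightarrow> intertwines v T"
proof
  assume "intertwines v T"
  then have z: "transpose v ** slice T i = slice T i ** v" for i by (simp add: intertwines_def)
  have "(defect v T x *v y) $ i = 0" for x y i
    unfolding defect_slice z by simp
  then have z: "defect v T x = 0" for x by (simp add: matrix_eq vec_eq_iff[of "_ *v _"])
  then have "transpose (defect v T x) = 0" "defect v T x = 0" for x
    by (simp_all add: z transpose_def vec_eq_iff[of _ 0])
  then show "\<forall>i j. nij (axis i 1) (axis j 1) = 0"
    by (simp add: nij_eq del: transpose_matrix_vector)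
next
  assume *: "\<forall>i j. nij (axis i 1) (axis j 1) = 0"
  define q where "q x y z = (defect v T x *v y) \<bullet> (l *v z)" for x y z
  have anti: "q x y z = - q y x z" for x y z
    unfolding q_def by (subst defect_antisym[OF Ts]) simp
  have cyc: "q (axis i 1) (axis j 1) z + q (axis i 1) z (axis j 1) - q (axis j 1) z (axis i 1) = 0" for i j z
  proof -
    let ?x = "axis i 1" and ?y = "axis j 1"
    let ?X = "l *v (defect v T ?x *v ?y) + transpose (defect v T ?x) *v (l *v ?y)
      - transpose (defect v T ?y) *v (l *v ?x)"
    have "g *v ?X = 0" using * nij_eq by metis
    then have "(matrix_inv g ** g) *v ?X = 0"
      by (simp only: matrix_vector_mul_assoc[symmetric] matrix_vector_mult_0_right)
    then have "?X \<bullet> z = 0" by (simp only: matrix_inv_inverse[OF gd] matrix_vector_mul_lid inner_zero_left)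
    moreover have "(l *v a) \<bullet> z = a \<bullet> (l *v z)" for a
      using transpose_mult_inner[of l a z] by (simp only: ls)
    ultimately show ?thesis
      by (simp only: inner_add_left inner_diff_left transpose_mult_inner q_def
          inner_commute[of "l *v axis _ 1"])
  qed
  have "q (axis i 1) (axis j 1) (axis k 1) = 0" for i j k
    using cyc[of i j "axis k 1"] cyc[of j k "axis i 1"] cyc[of k i "axis j 1"]
      anti[of "axis i 1" "axis j 1" "axis k 1"] anti[of "axis j 1" "axis k 1" "axis i 1"]
      anti[of "axis k 1" "axis i 1" "axis j 1"]
    by linarith
  moreover have "(l *v a) $ k = a \<bullet> (l *v axis k 1)" for a k
    using transpose_mult_inner[of l a "axis k 1"] by (simp add: ls inner_axis del: transpose_matrix_vector)
  ultimately have "l *v (defect v T (axis i 1) *v axis j 1) = 0" for i j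
    by (simp add: q_def vec_eq_iff[of _ 0])
  then have "(h ** l) *v (defect v T (axis i 1) *v axis j 1) = 0" for i j
    by (simp flip: matrix_vector_mul_assoc)
  then have "defect v T (axis i 1) *v axis j 1 = 0" for i j
    by (simp add: hl)
  then show "intertwines v T" by (simp add: intertwines_iff_defect)
qed


section \<open>A nondegenerate member of the pencil\<close>

context
  fixes a b :: real and m r :: "real^'n^'n"
  assumes m: "m = a *\<^sub>R g + b *\<^sub>R h" and mr: "m ** r = mat 1" and rm: "r ** m = mat 1"
begin

text \<open>The only family compatible with linearity of \<open>\<Gamma>\<^sup>i\<^sup>j\<^sub>k\<close> in the pencil; it is the Levi-Civita
  connection of \<open>m\<close> as soon as it is symmetric.\<close>

definition F where "F k = C k + b *\<^sub>R (T k ** (h ** r))"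

lemma F_m: "F k ** m = a *\<^sub>R (C k ** g) + b *\<^sub>R (C' k ** h)"
proof -
  have "F k ** m = C k ** m + b *\<^sub>R (T k ** h ** (r ** m))"
    by (simp add: F_def mat_ring)
  then show ?thesis by (simp add: rm) (simp add: m T_def mat_ring algebra_simps)
qed

lemma ms: "transpose m = m"
  by (simp add: m mat_ring gs hs)

lemma rs: "transpose r = r"
  using ms mr rm by (metis matrix_mul_assoc matrix_mul_lid matrix_mul_rid matrix_transpose_mul transpose_mat)

lemma av_b: "a *\<^sub>R v + b *\<^sub>R mat 1 = m ** l"
  by (simp add: v_def m hl mat_ring)

text \<open>Since \<open>a v + b\<close> equals \<open>m ** l\<close>, its inverse is
  \<open>h ** r\<close>. Conditions on \<open>h ** r\<close>, which occurs in \<open>F\<close>,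
  thereby become conditions on \<open>v\<close>.\<close>

lemma w_inverse: "(h ** r) ** (a *\<^sub>R v + b *\<^sub>R mat 1) = mat 1"
    "(a *\<^sub>R v + b *\<^sub>R mat 1) ** (h ** r) = mat 1"
proof -
  have "(h ** r) ** (m ** l) = h ** (r ** m) ** l" "(m ** l) ** (h ** r) = m ** (l ** h) ** r"
    by (simp_all add: matrix_mul_assoc)
  then show "(h ** r) ** (a *\<^sub>R v + b *\<^sub>R mat 1) = mat 1" "(a *\<^sub>R v + b *\<^sub>R mat 1) ** (h ** r) = mat 1"
    by (simp_all add: av_b rm lh hl mr)
qed

text \<open>\<open>C\<close> is symmetric, so only the correction \<open>T k ** (h ** r)\<close>
  matters, and transposing its slice moves \<open>h ** r\<close> to the other side. The factor
  \<open>b\<close> stays because it may be zero here.\<close>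

lemma sym_F_iff: "sym_family F \<longleftrightarrow>
    (\<forall>i. b *\<^sub>R (transpose (h ** r) ** slice T i) = b *\<^sub>R (slice T i ** (h ** r)))"
proof -
  have "transpose (slice F i) = slice F i \<longleftrightarrow>
      b *\<^sub>R (transpose (h ** r) ** slice T i) = b *\<^sub>R (slice T i ** (h ** r))" for i
    using Cs Ts unfolding sym_family_slice F_def[abs_def] slice_lin_comb_mul
    by (simp add: transpose_add transpose_scalar matrix_transpose_mul)
  then show ?thesis by (simp add: sym_family_slice)
qed

lemma intertwines_imp_sym_F:
  assumes "intertwines v T"
  shows "sym_family F"
  unfolding sym_F_iff
proof
  fix i
  have "transpose (a *\<^sub>R v + b *\<^sub>R mat 1) ** slice T i = slice T i ** (a *\<^sub>R v + b *\<^sub>R mat 1)"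
    using assms by (simp add: intertwines_def mat_ring)
  from intertwine_inverse[OF this w_inverse(2)]
  show "b *\<^sub>R (transpose (h ** r) ** slice T i) = b *\<^sub>R (slice T i ** (h ** r))" by simp
qed

text \<open>Self-adjointness of \<open>h ** r\<close> passes to its inverse \<open>a v + b\<close>.
  Cancelling \<open>b\<close> exposes the condition on \<open>h ** r\<close>, and cancelling
  \<open>a\<close> isolates \<open>v\<close>.\<close>

lemma sym_F_imp_intertwines:
  assumes "sym_family F" "a \<noteq> 0" "b \<noteq> 0"
  shows "intertwines v T"
  unfolding intertwines_def
proof
  fix i
  have "transpose (h ** r) ** slice T i = slice T i ** (h ** r)"
    using assms by (simp add: sym_F_iff)
  from intertwine_inverse[OF this w_inverse(1)]
  have "a *\<^sub>R (transpose v ** slice T i) = a *\<^sub>R (slice T i ** v)"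
    by (simp add: mat_ring)
  then show "transpose v ** slice T i = slice T i ** v" using assms by simp
qed

lemma eq_F:
  assumes "m ** transpose (G k) = a *\<^sub>R (g ** transpose (C k)) + b *\<^sub>R (h ** transpose (C' k))"
  shows "G k = F k"
proof -
  have "G k ** m = F k ** m"
    using arg_cong[OF assms, of transpose] by (simp add: F_m mat_ring ms gs hs)
  then have "G k ** (m ** r) = F k ** (m ** r)" by (simp add: matrix_mul_assoc)
  then show ?thesis by (simp add: mr)
qed

lemma m_F: "m ** transpose (F k) = a *\<^sub>R (g ** transpose (C k)) + b *\<^sub>R (h ** transpose (C' k))"
  using arg_cong[OF F_m[of k], of transpose] by (simp add: mat_ring ms gs hs)

text \<open>Substitute \<open>C' = C + T\<close>: the terms in \<open>C\<close> alone and the mixed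
  ones agree on both sides, so the deviation from linearity is purely quadratic in
  \<open>T\<close>.\<close>

lemma quadratic_F:
  "F k ** m ** transpose (F j) = a *\<^sub>R (C k ** g ** transpose (C j)) + b *\<^sub>R (C' k ** h ** transpose (C' j))
     + b *\<^sub>R (T k ** (b *\<^sub>R (h ** r ** h) - h) ** transpose (T j))"
proof -
  have C': "C' k = C k + T k" for k by (simp add: T_def)
  have Fm: "F k ** m = C k ** m + b *\<^sub>R (T k ** h)"
    by (simp only: F_m C') (simp add: m mat_ring algebra_simps)
  have Ft: "transpose (F j) = transpose (C j) + b *\<^sub>R (r ** h ** transpose (T j))"
    by (simp add: F_def mat_ring hs rs)
  have "C k ** m ** (r ** h ** transpose (T j)) = C k ** (m ** r) ** h ** transpose (T j)"
    by (simp add: matrix_mul_assoc)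
  then have "C k ** m ** (r ** h ** transpose (T j)) = C k ** h ** transpose (T j)"
    by (simp add: mr)
  then have "F k ** m ** transpose (F j) = C k ** m ** transpose (C j) + b *\<^sub>R (C k ** h ** transpose (T j))
      + b *\<^sub>R (T k ** h ** transpose (C j)) + (b * b) *\<^sub>R (T k ** h ** r ** h ** transpose (T j))"
    by (simp add: Fm Ft matrix_add_ldistrib matrix_add_rdistrib matrix_mul_scaleR_left matrix_mul_scaleR_right
        scaleR_add_right) (simp add: matrix_mul_assoc)
  then show ?thesis
    by (simp add: C' m mat_ring algebra_simps)
qed

text \<open>The matrices \<open>h ** slice T i\<close> and \<open>y\<close> below all commute with \<open>v\<close>, hence with each other.\<close>

lemma difference_products_commute:
  assumes S: "intertwines v T"
    and card: "card {z::complex. det (\<chi> i j. of_real (g $ i $ j) - z * of_real (h $ i $ j)) = 0} = CARD('n)"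
  shows "T k ** (b *\<^sub>R (h ** r ** h) - h) ** transpose (T j) = T j ** (b *\<^sub>R (h ** r ** h) - h) ** transpose (T k)"
proof -
  define y where "y = b *\<^sub>R (h ** r) - mat 1"
  define K where "K = b *\<^sub>R (h ** r ** h) - h"
  have K: "K = y ** h" by (simp add: K_def y_def mat_ring)
  have Ks: "transpose K = K" by (simp add: K_def mat_ring hs rs)
  note cc = real_commutant_commutative[OF hl lh card, folded v_def]
  let ?P = "a *\<^sub>R v + b *\<^sub>R mat 1"
  \<comment> \<open>\<open>h ** r\<close> is the inverse of a polynomial in
    \<open>v\<close>.\<close>
  have "h ** r ** v = v ** (h ** r)"
  proof -
    have "h ** r ** v = (h ** r) ** v ** (?P ** (h ** r))" by (simp only: w_inverse matrix_mul_rid)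
    also have "\<dots> = (h ** r) ** (v ** ?P) ** (h ** r)" by (simp only: matrix_mul_assoc)
    also have "v ** ?P = ?P ** v" by (simp add: mat_ring)
    also have "(h ** r) ** (?P ** v) ** (h ** r) = ((h ** r) ** ?P) ** v ** (h ** r)" by (simp only: matrix_mul_assoc)
    finally show ?thesis by (simp only: w_inverse matrix_mul_lid)
  qed
  then have yv: "y ** v = v ** y" by (simp add: y_def mat_ring)
  \<comment> \<open>Intertwining moves \<open>v\<close> to the left as its transpose, and both
    \<open>h ** transpose v\<close> and \<open>v ** h\<close> equal \<open>g\<close>.\<close>
  have B: "(h ** slice T i) ** v = v ** (h ** slice T i)" for i
  proof -
    have "(h ** slice T i) ** v = h ** transpose v ** slice T i"
      using S by (simp add: intertwines_def flip: matrix_mul_assoc)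
    then show ?thesis by (simp add: hv matrix_mul_assoc vh)
  qed
  have BKB: "slice T i ** K ** slice T i' = slice T i' ** K ** slice T i" for i i'
  proof -
    let ?A = "h ** slice T i" and ?A' = "h ** slice T i'"
    have "h ** (slice T i ** K ** slice T i') = ?A ** y ** ?A'" "h ** (slice T i' ** K ** slice T i) = ?A' ** y ** ?A"
      by (simp_all add: K matrix_mul_assoc)
    moreover have "?A ** y ** ?A' = ?A' ** y ** ?A"
      by (metis (no_types) cc[OF B yv] cc[OF B B] matrix_mul_assoc)
    ultimately have "(l ** h) ** (slice T i ** K ** slice T i') = (l ** h) ** (slice T i' ** K ** slice T i)"
      by (metis matrix_mul_assoc)
    then show ?thesis by (simp add: lh)
  qed
  \<comment> \<open>Reading the contraction with \<open>k\<close>, \<open>j\<close> as matrix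
    indices turns their exchange into transposition of a product of slices. Transposition reverses
    that product, and \<open>BKB\<close> restores the order.\<close>
  have entry: "(T k ** K ** transpose (T j)) $ i $ i' = (slice T i ** K ** slice T i') $ k $ j" for i i' k j
  proof -
    have "slice T i' = transpose (slice T i')" using Ts by (simp add: sym_family_slice)
    then have "(slice T i ** K ** slice T i') $ k $ j = (slice T i ** K ** transpose (slice T i')) $ k $ j" by simp
    then show ?thesis by (simp add: matrix_matrix_mult_def transpose_def slice_def)
  qed
  have "(slice T i ** K ** slice T i') $ k $ j = (slice T i ** K ** slice T i') $ j $ k" for i i'
  proof -
    have "transpose (slice T i ** K ** slice T i') = slice T i' ** K ** slice T i"
      using Ts by (simp add: matrix_transpose_mul Ks sym_family_slice matrix_mul_assoc)
    then have "transpose (slice T i ** K ** slice T i') = slice T i ** K ** slice T i'" by (simp only: BKB)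
    then show ?thesis by (simp add: transpose_def vec_eq_iff)
  qed
  then show ?thesis by (simp add: vec_eq_iff entry flip: K_def)
qed

end

end

section \<open>Pairs of metric fields\<close>

lemma contravariant_metric_imp_metric_field:
  assumes "open U" "contravariant_metric U g"
  shows "metric_field U g"
proof
  have C2: "Ck_on (Suc (Suc 0)) U (\<lambda>u. g u $ i $ j)" for i j
    using assms by (simp add: contravariant_metric_def smooth_on_def del: Ck_on.simps)
  fix u assume u: "u \<in> U"
  show "g differentiable (at u)"
    using C2 u assms(1) by (simp add: matrix_differentiable_iff differentiable_on_eq_differentiable_at)
  show "partial_mat k g differentiable (at u)" for k
    unfolding matrix_differentiable_iff
    using C2 u assms(1) by (simp add: partial_mat_def differentiable_on_eq_differentiable_at)
  show "transpose (g u) = g u" "det (g u) \<noteq> 0"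
    using assms u by (auto simp: contravariant_metric_def)
qed (rule assms)

locale metric_field_pair = G1: metric_field U g1 + G2: metric_field U g2
  for U :: "(real^'n::finite) set" and g1 g2 :: "real^'n \<Rightarrow> real^'n^'n"
begin

lemma pair_at:
  assumes "u \<in> U"
  shows "metric_pair_at (g1 u) (g2 u) (lowered g2 u) (\<lambda>k. connection g1 k u) (\<lambda>k. connection g2 k u)"
  using assms
  by unfold_locales (simp_all add: G1.symm G2.symm G1.nondeg G2.inverse sym_family_def
      G1.connection_symm[OF assms, of _ _ _] G2.connection_symm[OF assms, of _ _ _])

text \<open>The pointwise condition to which both almost compatibility and vanishing of the
  Nijenhuis tensor are reduced.\<close>

definition defect_free :: "real^'n \<Rightarrow> bool" where
  "defect_free u \<longleftrightarrow> intertwines (g1 u ** lowered g2 u) (\<lambda>k. connection g2 k u - connection g1 k u)"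

lemma nijenhuis_eq_0_iff:
  assumes u: "u \<in> U"
  shows "(\<forall>k i j. nijenhuis (pair_affinor g1 g2) k i j u = 0) \<longleftrightarrow> defect_free u"
proof -
  interpret metric_pair_at "g1 u" "g2 u" "lowered g2 u" "\<lambda>k. connection g1 k u" "\<lambda>k. connection g2 k u"
    by (rule pair_at[OF u])
  have v: "pair_affinor g1 g2 u = v" by (simp add: pair_affinor_def v_def)
  \<comment> \<open>The product rule for \<open>g1\<close> times the lowered \<open>g2\<close>;
    metricity of both connections then eliminates all derivatives. The facts \<open>a\<close> and
    \<open>b\<close> cancel \<open>g2\<close> against its inverse.\<close>
  have D: "partial_mat k (pair_affinor g1 g2) u = deriv_v k" for k
  proof -
    have a: "g1 u ** lowered g2 u ** (g2 u ** transpose C ** lowered g2 u) = g1 u ** transpose C ** lowered g2 u" for C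
    proof -
      have "g1 u ** lowered g2 u ** (g2 u ** transpose C ** lowered g2 u)
        = g1 u ** (lowered g2 u ** g2 u) ** transpose C ** lowered g2 u" by (simp only: matrix_mul_assoc)
      then show ?thesis by (simp add: lh)
    qed
    have b: "g1 u ** (lowered g2 u ** (C ** g2 u) ** lowered g2 u) = v ** C" for C
    proof -
      have "g1 u ** (lowered g2 u ** (C ** g2 u) ** lowered g2 u) = v ** C ** (g2 u ** lowered g2 u)"
        by (simp only: matrix_mul_assoc v_def)
      then show ?thesis by (simp add: hl)
    qed
    have "partial_mat k (pair_affinor g1 g2) u
        = partial_mat k g1 u ** lowered g2 u + g1 u ** partial_mat k (lowered g2) u"
      unfolding pair_affinor_def[abs_def] using u
      by (simp add: partial_mat_mul G1.diff G2.lowered_diff)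
    then show ?thesis
      unfolding G2.partial_lowered[OF u] G1.connection_metric[OF u] G2.connection_metric[OF u]
      using a[of "connection g2 k u"] b[of "connection g2 k u"]
      by (simp add: deriv_v_def T_def v_def mat_ring)
  qed
  have "nijenhuis (pair_affinor g1 g2) k i j u = nij (axis i 1) (axis j 1) $ k" for k i j
  proof -
    have e: "(M *v axis j 1) $ k = M $ k $ j" for M :: "real^'n^'n" and j k
      by (simp only: matrix_vector_mult_basis column_def vec_lambda_beta)
    have "nij (axis i 1) (axis j 1) $ k
        = (\<Sum>s\<in>UNIV. v $ s $ i * deriv_v s $ k $ j) - (\<Sum>s\<in>UNIV. v $ s $ j * deriv_v s $ k $ i)
          + (\<Sum>s\<in>UNIV. v $ k $ s * deriv_v j $ s $ i) - (\<Sum>s\<in>UNIV. v $ k $ s * deriv_v i $ s $ j)"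
      by (simp only: nij_def along_axis matrix_vector_mul_assoc vector_add_component vector_minus_component e
          along_nth) (simp add: matrix_matrix_mult_def)
    then show ?thesis
      by (simp add: nijenhuis_def v partial_mat_def sum_subtractf sum.distrib flip: D)
  qed
  then show ?thesis
    using nij_eq_0_iff by (auto simp: defect_free_def v_def T_def[abs_def] vec_eq_iff)
qed

text \<open>The nondegenerate locus is open by continuity of the determinant, so all facts about
  Levi-Civita connections apply to the combination there.\<close>

lemma lin_comb_metric_field:
  "metric_field {u \<in> U. det (lin_comb a g1 b g2 u) \<noteq> 0} (lin_comb a g1 b g2)"
proof
  have d: "lin_comb a g1 b g2 differentiable (at u)" if "u \<in> U" for u
    unfolding lin_comb_def[abs_def] using that G1.diff G2.diff
    by (intro differentiable_add differentiable_scaleR differentiable_const)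
  have "continuous_on U (\<lambda>u. det (lin_comb a g1 b g2 u))"
    using d det_differentiable G1.open_U
    by (blast intro: differentiable_imp_continuous_within continuous_at_imp_continuous_on)
  from continuous_open_preimage[OF this G1.open_U, of "- {0}"]
  show op: "open {u \<in> U. det (lin_comb a g1 b g2 u) \<noteq> 0}"
    by (simp add: vimage_def Int_def open_Compl)
  fix u assume u': "u \<in> {u \<in> U. det (lin_comb a g1 b g2 u) \<noteq> 0}"
  then have u: "u \<in> U" by simp
  show "lin_comb a g1 b g2 differentiable (at u)" by (rule d[OF u])
  show "partial_mat k (lin_comb a g1 b g2) differentiable (at u)" for k
  proof (rule differentiable_cong_open[OF G1.open_U u])
    show "(\<lambda>u. a *\<^sub>R partial_mat k g1 u + b *\<^sub>R partial_mat k g2 u) differentiable (at u)"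
      using u G1.diff2 G2.diff2 by (intro differentiable_add differentiable_scaleR differentiable_const)
    show "a *\<^sub>R partial_mat k g1 x + b *\<^sub>R partial_mat k g2 x = partial_mat k (lin_comb a g1 b g2) x"
      if "x \<in> U" for x
      unfolding lin_comb_def[abs_def] using that by (simp add: partial_mat_lin_comb G1.diff G2.diff)
  qed
  show "transpose (lin_comb a g1 b g2 u) = lin_comb a g1 b g2 u"
    using u by (simp add: lin_comb_def mat_ring G1.symm G2.symm)
  show "det (lin_comb a g1 b g2 u) \<noteq> 0" using u' by simp
qed

context
  fixes a b :: real and u :: "real^'n"
  assumes u: "u \<in> U" and det: "det (lin_comb a g1 b g2 u) \<noteq> 0"
begin

interpretation metric_pair_at "g1 u" "g2 u" "lowered g2 u" "\<lambda>k. connection g1 k u" "\<lambda>k. connection g2 k u"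
  by (rule pair_at[OF u])

interpretation L: metric_field "{u \<in> U. det (lin_comb a g1 b g2 u) \<noteq> 0}" "lin_comb a g1 b g2"
  by (rule lin_comb_metric_field)

abbreviation m where "m \<equiv> lin_comb a g1 b g2 u"
abbreviation r where "r \<equiv> lowered (lin_comb a g1 b g2) u"

lemma uL: "u \<in> {u \<in> U. det (lin_comb a g1 b g2 u) \<noteq> 0}"
  using u det by simp

lemma mr: "m = a *\<^sub>R g1 u + b *\<^sub>R g2 u" "m ** r = mat 1" "r ** m = mat 1"
  using L.inverse[OF uL] by (simp_all add: lin_comb_def)

lemma defect_free_iff: "defect_free u \<longleftrightarrow> intertwines v T"
  by (simp add: defect_free_def v_def T_def[abs_def])

lemma sym_connection: "sym_family (\<lambda>k. connection (lin_comb a g1 b g2) k u)"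
  unfolding sym_family_def using L.connection_symm[OF uL] by blast

text \<open>Linearity forces the connection of the combination to be \<open>F\<close>. A Levi-Civita
  connection has no torsion, so \<open>F\<close> is symmetric, which is the intertwining
  condition.\<close>

lemma contra_connection_lin_comb_imp:
  assumes "a \<noteq> 0" "b \<noteq> 0"
    and "\<And>k. contra_connection (lin_comb a g1 b g2) k u
       = a *\<^sub>R contra_connection g1 k u + b *\<^sub>R contra_connection g2 k u"
  shows "defect_free u"
proof -
  have "connection (lin_comb a g1 b g2) k u = F b r k" for k
    using eq_F[OF mr, of "\<lambda>k. connection (lin_comb a g1 b g2) k u" k] assms(3)[of k]
    by (simp add: contra_connection_def)
  then have "sym_family (F b r)" using sym_connection by simp
  with sym_F_imp_intertwines[OF mr] assms(1,2) show ?thesis by (simp add: defect_free_iff)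
qed

text \<open>\<open>F\<close> has no torsion by the intertwining condition, and it is metric because
  the derivative of the combination is linear in the two metrics. Uniqueness of the Levi-Civita
  connection does the rest.\<close>

lemma connection_lin_comb:
  assumes "defect_free u"
  shows "connection (lin_comb a g1 b g2) k u = F b r k"
proof (rule levi_civita_unique[OF sym_connection _ _ mr(2,3)])
  show "sym_family (F b r)"
    using intertwines_imp_sym_F[OF mr] assms by (simp add: defect_free_iff)
  show "transpose m = m" by (rule ms[OF mr])
  fix k
  have P: "partial_mat k (lin_comb a g1 b g2) u = a *\<^sub>R partial_mat k g1 u + b *\<^sub>R partial_mat k g2 u"
    unfolding lin_comb_def[abs_def] using u by (simp add: partial_mat_lin_comb G1.diff G2.diff)
  have "- (connection (lin_comb a g1 b g2) k u ** m + m ** transpose (connection (lin_comb a g1 b g2) k u))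
      = - (F b r k ** m + m ** transpose (F b r k))"
    using P unfolding L.connection_metric[OF uL] G1.connection_metric[OF u] G2.connection_metric[OF u]
    by (simp add: F_m[OF mr] m_F[OF mr] algebra_simps)
  then show "connection (lin_comb a g1 b g2) k u ** m + m ** transpose (connection (lin_comb a g1 b g2) k u)
      = F b r k ** m + m ** transpose (F b r k)" by (simp only: neg_equal_iff_equal)
qed

lemma contra_connection_lin_comb:
  assumes "defect_free u"
  shows "contra_connection (lin_comb a g1 b g2) k u
     = a *\<^sub>R contra_connection g1 k u + b *\<^sub>R contra_connection g2 k u"
  using m_F[OF mr, of k] by (simp add: contra_connection_def connection_lin_comb[OF assms])

text \<open>By \<open>P\<close> the derivative terms are linear. The quadratic terms deviate by a
  product that is symmetric in \<open>k\<close> and \<open>l\<close> and so drops out on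
  antisymmetrising. \<open>P\<close> is a premise since it needs a neighbourhood, while here
  \<open>u\<close> is fixed.\<close>

lemma contra_riemann_lin_comb_aux:
  assumes S: "defect_free u"
    and card: "card {z::complex. det (\<chi> i j. of_real (g1 u $ i $ j) - z * of_real (g2 u $ i $ j)) = 0} = CARD('n)"
    and P: "\<And>k j. partial_mat k (contra_connection (lin_comb a g1 b g2) j) u
        = a *\<^sub>R partial_mat k (contra_connection g1 j) u + b *\<^sub>R partial_mat k (contra_connection g2 j) u"
  shows "contra_riemann (lin_comb a g1 b g2) i j k l u
     = a * contra_riemann g1 i j k l u + b * contra_riemann g2 i j k l u"
proof -
  have "T k ** (b *\<^sub>R (g2 u ** r ** g2 u) - g2 u) ** transpose (T l)
      = T l ** (b *\<^sub>R (g2 u ** r ** g2 u) - g2 u) ** transpose (T k)"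
    using difference_products_commute[OF mr _ card] S by (simp add: defect_free_iff)
  then show ?thesis
    unfolding L.contra_riemann_eq[OF uL] G1.contra_riemann_eq[OF u] G2.contra_riemann_eq[OF u]
      connection_lin_comb[OF S] quadratic_F[OF mr] P
    by (simp add: algebra_simps)
qed

end

text \<open>Linearity of \<open>contra_connection\<close> holds on the whole open nondegenerate
  locus and may be differentiated there; hence \<open>defect_free\<close> is required throughout
  \<open>U\<close>.\<close>

lemma contra_riemann_lin_comb:
  assumes S: "\<And>x. x \<in> U \<Longrightarrow> defect_free x" and u: "u \<in> U" "det (lin_comb a g1 b g2 u) \<noteq> 0"
    and card: "card {z::complex. det (\<chi> i j. of_real (g1 u $ i $ j) - z * of_real (g2 u $ i $ j)) = 0} = CARD('n)"
  shows "contra_riemann (lin_comb a g1 b g2) i j k l u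
     = a * contra_riemann g1 i j k l u + b * contra_riemann g2 i j k l u"
proof (rule contra_riemann_lin_comb_aux[OF u S[OF u(1)] card])
  fix k j
  let ?V = "{u \<in> U. det (lin_comb a g1 b g2 u) \<noteq> 0}"
  interpret L: metric_field ?V "lin_comb a g1 b g2" by (rule lin_comb_metric_field)
  have "partial_mat k (contra_connection (lin_comb a g1 b g2) j) u
      = partial_mat k (\<lambda>x. a *\<^sub>R contra_connection g1 j x + b *\<^sub>R contra_connection g2 j x) u"
    using u L.open_U
    by (intro partial_mat_cong_open[where U = ?V] L.contra_connection_diff) (auto intro: contra_connection_lin_comb S)
  then show "partial_mat k (contra_connection (lin_comb a g1 b g2) j) u
      = a *\<^sub>R partial_mat k (contra_connection g1 j) u + b *\<^sub>R partial_mat k (contra_connection g2 j) u"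
    using u by (simp add: partial_mat_lin_comb G1.contra_connection_diff G2.contra_connection_diff)
qed

text \<open>At \<open>b = 0\<close> the determinant is that of \<open>g1\<close>, so by continuity
  small nonzero \<open>b\<close> work. This supplies the two nonzero coefficients that
  \<open>contra_connection_lin_comb_imp\<close> asks for.\<close>

lemma nondegenerate_lin_comb:
  assumes "u \<in> U"
  obtains b where "b \<noteq> 0" "det (lin_comb 1 g1 b g2 u) \<noteq> 0"
proof -
  have "(\<lambda>b. lin_comb 1 g1 b g2 u) differentiable (at 0)"
    unfolding lin_comb_def by (intro derivative_intros)
  then have "continuous (at 0) (\<lambda>b. det (lin_comb 1 g1 b g2 u))"
    by (intro differentiable_imp_continuous_within det_differentiable)
  then have "((\<lambda>b. det (lin_comb 1 g1 b g2 u)) \<longlongrightarrow> det (g1 u)) (at 0)"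
    by (simp add: continuous_at lin_comb_def)
  then have "\<forall>\<^sub>F b in at 0. det (lin_comb 1 g1 b g2 u) \<noteq> 0"
    using G1.nondeg[OF assms] by (rule tendsto_imp_eventually_ne)
  moreover have "\<forall>\<^sub>F b::real in at 0. b \<noteq> 0" by (rule eventually_neq_at_within)
  ultimately have "\<exists>b::real. det (lin_comb 1 g1 b g2 u) \<noteq> 0 \<and> b \<noteq> 0"
    by (intro eventually_happens'[OF at_neq_bot] eventually_conj)
  then show thesis using that by blast
qed

section \<open>From the pointwise condition to compatibility\<close>

lemma contra_christoffel_lin_comb_iff:
  "(\<forall>i j k. contra_christoffel (lin_comb a g1 b g2) i j k u
      = a * contra_christoffel g1 i j k u + b * contra_christoffel g2 i j k u)
    \<longleftrightarrow> (\<forall>k. contra_connection (lin_comb a g1 b g2) k u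
      = a *\<^sub>R contra_connection g1 k u + b *\<^sub>R contra_connection g2 k u)"
  by (auto simp: contra_christoffel_eq contra_connection_def vec_eq_iff)

lemma almost_compatible_iff: "almost_compatible U g1 g2 \<longleftrightarrow> (\<forall>u\<in>U. defect_free u)"
proof
  assume A: "almost_compatible U g1 g2"
  show "\<forall>u\<in>U. defect_free u"
  proof
    fix u assume u: "u \<in> U"
    \<comment> \<open>One combination per point is enough; \<open>b\<close> may vary with
      \<open>u\<close>.\<close>
    obtain b where b: "b \<noteq> 0" "det (lin_comb 1 g1 b g2 u) \<noteq> 0"
      by (rule nondegenerate_lin_comb[OF u])
    then have "\<forall>i j k. contra_christoffel (lin_comb 1 g1 b g2) i j k u
      = 1 * contra_christoffel g1 i j k u + b * contra_christoffel g2 i j k u"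
      using A u unfolding almost_compatible_def by blast
    then show "defect_free u"
      unfolding contra_christoffel_lin_comb_iff
      using contra_connection_lin_comb_imp[OF u b(2)] b(1) by simp
  qed
next
  assume "\<forall>u\<in>U. defect_free u"
  then show "almost_compatible U g1 g2"
    unfolding almost_compatible_def contra_christoffel_lin_comb_iff
    by (auto intro: contra_connection_lin_comb)
qed

lemma compatible_imp_almost_compatible: "compatible U g1 g2 \<Longrightarrow> almost_compatible U g1 g2"
  unfolding compatible_def almost_compatible_def by blast

lemma defect_free_imp_compatible:
  assumes "nonsingular_pair U g1 g2" "\<forall>u\<in>U. defect_free u"
  shows "compatible U g1 g2"
  using assms unfolding compatible_def contra_christoffel_lin_comb_iff nonsingular_pair_def
  by (auto intro: contra_connection_lin_comb contra_riemann_lin_comb)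

lemma nijenhuis_vanishes_iff: "nijenhuis_vanishes U (pair_affinor g1 g2) \<longleftrightarrow> (\<forall>u\<in>U. defect_free u)"
  unfolding nijenhuis_vanishes_def using nijenhuis_eq_0_iff by blast

end

theorem theorem2p4:
  fixes U :: "(real^'n::finite) set" and g1 g2 :: "real^'n \<Rightarrow> real^'n^'n"
  assumes "open U"
    and "contravariant_metric U g1" and "contravariant_metric U g2"
  shows "(almost_compatible U g1 g2 \<longrightarrow> nijenhuis_vanishes U (pair_affinor g1 g2)) \<and>
    (compatible U g1 g2 \<longrightarrow> nijenhuis_vanishes U (pair_affinor g1 g2)) \<and>
    (nonsingular_pair U g1 g2 \<longrightarrow>
       (nijenhuis_vanishes U (pair_affinor g1 g2) \<longrightarrow> compatible U g1 g2) \<and>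
       (compatible U g1 g2 \<longleftrightarrow> almost_compatible U g1 g2))"
proof -
  interpret metric_field_pair U g1 g2
    using assms by (intro metric_field_pair.intro contravariant_metric_imp_metric_field)
  show ?thesis
    using almost_compatible_iff nijenhuis_vanishes_iff compatible_imp_almost_compatible
      defect_free_imp_compatible by blast
qed

end
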